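(* Let $\mathbb{K}$ be a field of characteristic zero and let $\mathfrak{g}=\mathfrak{g}_{\bar 0}\oplus\mathfrak{g}_{\bar 1}$ be a finite-dimensional Lie superalgebra over $\mathbb{K}$. If $\mathfrak{g}$ admits an even invertible superderivation, then $\mathfrak{g}$ is nilpotent.
   Context: A Lie superalgebra is a $\mathbb{Z}_2$-graded vector space $\mathfrak{g}=\mathfrak{g}_{\bar 0}\oplus\mathfrak{g}_{\bar 1}$ with an even bilinear bracket satisfying, for homogeneous $X,Y,Z$ of degrees $x,y,z$, $[X,Y]=-(-1)^{xy}[Y,X]$ and $(-1)^{xz}[X,[Y,Z]]+(-1)^{xy}[Y,[Z,X]]+(-1)^{yz}[Z,[X,Y]]=0$. An even superderivation is a linear map $D:\mathfrak{g}\to\mathfrak{g}$ with $D(\mathfrak{g}_{\bar i})\subseteq\mathfrak{g}_{\bar i}$ and $D([X,Y])=[D(X),Y]+[X,D(Y)]$ for all $X,Y$. $\mathfrak{g}$ is nilpotent if $\mathcal{C}^k(\mathfrak{g})=\{0\}$ for some $k$, where $\mathcal{C}^0(\mathfrak{g})=\mathfrak{g}$ and $\mathcal{C}^{k+1}(\mathfrak{g})=[\mathcal{C}^k(\mathfrak{g}),\mathfrak{g}]$. *)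

theory Defs
  imports Complex_Main "HOL-Library.Z2"
begin

text \<open>
  The sign \<open>(-1)^(xy)\<close>; the type \<open>bit\<close> is the field of integers modulo 2.
\<close>
definition koszul_sign :: "bit \<Rightarrow> bit \<Rightarrow> 'k::field" where
  "koszul_sign x y = (if x = 1 \<and> y = 1 then - 1 else 1)"

text \<open>
  The underlying vector space is the whole type \<open>'a\<close>, with scalar multiplication
  \<open>scale\<close>; \<open>gr i\<close> is the homogeneous component of degree \<open>i\<close>.
  The zero vector is homogeneous of both degrees.
\<close>
locale lie_superalgebra = vector_space scale
  for scale :: "'k::field \<Rightarrow> 'a::ab_group_add \<Rightarrow> 'a"  (infixr \<open>*s\<close> 75) +
  fixes br :: "'a \<Rightarrow> 'a \<Rightarrow> 'a"
    and gr :: "bit \<Rightarrow> 'a set"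
  assumes subspace_gr: "subspace (gr i)"
    and gr_sum: "\<exists>u\<in>gr 0. \<exists>w\<in>gr 1. v = u + w"
    and gr_disjoint: "gr 0 \<inter> gr 1 = {0}"
    and linear_br_right: "Vector_Spaces.linear scale scale (\<lambda>Y. br X Y)"
    and linear_br_left: "Vector_Spaces.linear scale scale (\<lambda>X. br X Y)"
    and br_even: "\<lbrakk>X \<in> gr x; Y \<in> gr y\<rbrakk> \<Longrightarrow> br X Y \<in> gr (x + y)"
    and super_skew: "\<lbrakk>X \<in> gr x; Y \<in> gr y\<rbrakk> \<Longrightarrow> br X Y = - (koszul_sign x y *s br Y X)"
    and super_jacobi: "\<lbrakk>X \<in> gr x; Y \<in> gr y; Z \<in> gr z\<rbrakk> \<Longrightarrow>
      koszul_sign x z *s br X (br Y Z) + koszul_sign x y *s br Y (br Z X)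
        + koszul_sign y z *s br Z (br X Y) = 0"

definition even_superderivation ::
  "('k::field \<Rightarrow> 'a::ab_group_add \<Rightarrow> 'a) \<Rightarrow> ('a \<Rightarrow> 'a \<Rightarrow> 'a) \<Rightarrow> (bit \<Rightarrow> 'a set) \<Rightarrow> ('a \<Rightarrow> 'a) \<Rightarrow> bool" where
  "even_superderivation scale br gr D \<longleftrightarrow>
     Vector_Spaces.linear scale scale D \<and>
     (\<forall>i. D ` gr i \<subseteq> gr i) \<and>
     (\<forall>X Y. D (br X Y) = br (D X) Y + br X (D Y))"

text \<open>
  As usual, the bracket of two subspaces is the linear span of the brackets of their elements.
\<close>
definition bracket_space ::
  "('k::field \<Rightarrow> 'a::ab_group_add \<Rightarrow> 'a) \<Rightarrow> ('a \<Rightarrow> 'a \<Rightarrow> 'a) \<Rightarrow> 'a set \<Rightarrow> 'a set \<Rightarrow> 'a set" where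
  "bracket_space scale br A B = module.span scale {br X Y | X Y. X \<in> A \<and> Y \<in> B}"

primrec lower_central ::
  "('k::field \<Rightarrow> 'a::ab_group_add \<Rightarrow> 'a) \<Rightarrow> ('a \<Rightarrow> 'a \<Rightarrow> 'a) \<Rightarrow> nat \<Rightarrow> 'a set" where
  "lower_central scale br 0 = UNIV"
| "lower_central scale br (Suc k) = bracket_space scale br (lower_central scale br k) UNIV"

definition nilpotent_superalgebra ::
  "('k::field \<Rightarrow> 'a::ab_group_add \<Rightarrow> 'a) \<Rightarrow> ('a \<Rightarrow> 'a \<Rightarrow> 'a) \<Rightarrow> bool" where
  "nilpotent_superalgebra scale br \<longleftrightarrow> (\<exists>k. lower_central scale br k = {0})"

end

theory Submission
  imports Defs "HOL-Algebra.Algebraic_Closure_Type" "HOL-Library.Function_Algebras"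
begin

text \<open>
  After extending scalars to the algebraic closure, the homogeneous generalized eigenvectors of
  the derivation \<open>D\<close> span the algebra. Brackets of such eigenvectors are again of this kind, with
  eigenvalues adding up; since there are finitely many eigenvalues, none of them zero, right
  multiplication by each of them is nilpotent in characteristic zero. Jacobson's version of
  Engel's theorem for weakly closed sets then makes all long products vanish, and this descends
  to the original field.

  The Engel argument enlarges a closed set \<open>T\<close> of eigenvectors whose long products vanish. As long
  as \<open>T\<close> does not span, some eigenvector \<open>s\<close> outside \<open>span T\<close> normalizes \<open>span T\<close>, because
  otherwise one could form arbitrarily long nonzero products with entries in \<open>T\<close>. In a long
  product with entries in \<open>T\<close> and \<open>s\<close>, either many entries lie in \<open>T\<close> or \<open>s\<close> occurs many times
  in a row, so \<open>T\<close> together with \<open>s\<close> is again such a set.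
\<close>

subsection \<open>Engel's theorem for weakly closed sets\<close>

context vector_space
begin

text \<open>Reduces a bilinear identity to generators, one argument at a time; the two subspace
  conditions are linearity in each variable.\<close>

lemma span_induct2:
  assumes "x \<in> span A" "y \<in> span C"
    and "\<And>y. subspace {x. P x y}" "\<And>x. subspace {y. P x y}"
    and "\<And>a c. a \<in> A \<Longrightarrow> c \<in> C \<Longrightarrow> P a c"
  shows "P x y"
proof -
  have "P a y" if "a \<in> A" for a
    by (rule span_induct[OF assms(2)]) (use that assms(4,5) in auto)
  then show ?thesis
    by (intro span_induct[OF assms(1), of "\<lambda>x. P x y"]) (use assms(3) in auto)
qed

end

locale bilinear_algebra = vector_space scale
  for scale :: "'k::field \<Rightarrow> 'v::ab_group_add \<Rightarrow> 'v"  (infixr \<open>*s\<close> 75) +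
  fixes br :: "'v \<Rightarrow> 'v \<Rightarrow> 'v"
  assumes br_add_left: "br (x + y) z = br x z + br y z"
    and br_add_right: "br x (y + z) = br x y + br x z"
    and br_scale_left: "br (c *s x) y = c *s br x y"
    and br_scale_right: "br x (c *s y) = c *s br x y"
begin

lemma br_zero_left [simp]: "br 0 y = 0"
  using br_scale_left[of 0 0 y] by simp

lemma br_zero_right [simp]: "br x 0 = 0"
  using br_scale_right[of x 0 0] by simp

lemma br_sum_left: "br (\<Sum>i\<in>I. f i) y = (\<Sum>i\<in>I. br (f i) y)"
  by (induction I rule: infinite_finite_induct) (auto simp: br_add_left)

lemma br_sum_right: "br x (\<Sum>i\<in>I. f i) = (\<Sum>i\<in>I. br x (f i))"
  by (induction I rule: infinite_finite_induct) (auto simp: br_add_right)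

lemma br_span_in_subspace:
  assumes "subspace E" "\<And>a c. a \<in> A \<Longrightarrow> c \<in> C \<Longrightarrow> br a c \<in> E"
    and "x \<in> span A" "y \<in> span C"
  shows "br x y \<in> E"
  using assms(3,4)
proof (rule span_induct2)
  show "subspace {x. br x y \<in> E}" for y
    using assms(1) by (auto simp: subspace_def br_add_left br_scale_left)
  show "subspace {y. br x y \<in> E}" for x
    using assms(1) by (auto simp: subspace_def br_add_right br_scale_right)
qed (rule assms(2))

lemma word_zero [simp]: "foldl br 0 xs = 0"
  by (induction xs) auto

text \<open>Words \<open>foldl br v xs\<close> are left-normed products, that is, successive right
  multiplications applied to \<open>v\<close>. They are multilinear, so expanding the start and each
  entry gives words of the same length in the generators.\<close>

lemma word_in_span:
  assumes "xs \<in> lists (span T)" "v \<in> span S"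
  shows "foldl br v xs \<in> span {foldl br w ys | w ys. w \<in> S \<and> ys \<in> lists T \<and> length ys = length xs}"
  using assms(1)
proof (induction xs rule: rev_induct)
  case Nil
  have "{foldl br w ys | w ys. w \<in> S \<and> ys \<in> lists T \<and> length ys = length []} = S"
    by auto
  then show ?case using assms(2) by simp
next
  case (snoc x xs)
  let ?E = "\<lambda>n. {foldl br w ys | w ys. w \<in> S \<and> ys \<in> lists T \<and> length ys = n}"
  have "br (foldl br v xs) x \<in> span (?E (Suc (length xs)))"
  proof (rule br_span_in_subspace[OF subspace_span])
    show "foldl br v xs \<in> span (?E (length xs))" "x \<in> span T"
      using snoc by auto
  next
    fix a t assume "a \<in> ?E (length xs)" and t: "t \<in> T"
    then obtain w ys where *: "a = foldl br w ys" "w \<in> S" "ys \<in> lists T" "length ys = length xs"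
      by blast
    show "br a t \<in> span (?E (Suc (length xs)))"
      by (rule span_base) (rule CollectI, rule exI[of _ w], rule exI[of _ "ys @ [t]"], use * t in auto)
  qed
  then show ?case by simp
qed

lemma word_vanish_span:
  assumes "\<And>w ys. w \<in> S \<Longrightarrow> ys \<in> lists T \<Longrightarrow> length ys = length xs \<Longrightarrow> foldl br w ys = 0"
    and "xs \<in> lists (span T)" "v \<in> span S"
  shows "foldl br v xs = 0"
proof -
  have "{foldl br w ys | w ys. w \<in> S \<and> ys \<in> lists T \<and> length ys = length xs} \<subseteq> {0}"
    using assms(1) by auto
  then have "span {foldl br w ys | w ys. w \<in> S \<and> ys \<in> lists T \<and> length ys = length xs} \<subseteq> {0}"
    by (rule span_minimal) (rule subspace_single_0)
  with word_in_span[OF assms(2,3)] show ?thesis by auto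
qed

end

text \<open>The scalars \<open>c\<close> absorb the signs, so no grading is mentioned. With right
  multiplications R, \<open>swap\<close> says that R_b R_a - c R_a R_b is R of
  \<open>br a b\<close>, which is Jacobson's condition; \<open>c\<close> depends on the pair but not
  on \<open>v\<close>. \<open>S\<close> need not be a subspace. \<open>square_square\<close> serves
  the case in which a normalizing element has to be replaced by its square.\<close>

locale weakly_closed = bilinear_algebra scale br
  for scale :: "'k::field \<Rightarrow> 'v::ab_group_add \<Rightarrow> 'v"  (infixr \<open>*s\<close> 75) and br +
  fixes S F :: "'v set"
  assumes finite_F: "finite F" and S_sub: "S \<subseteq> span F"
    and closed: "a \<in> S \<Longrightarrow> b \<in> S \<Longrightarrow> br a b \<in> S"
    and skew: "a \<in> S \<Longrightarrow> b \<in> S \<Longrightarrow> \<exists>c. br a b = c *s br b a"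
    and swap: "a \<in> S \<Longrightarrow> b \<in> S \<Longrightarrow>
      \<exists>c. \<forall>v\<in>S. br (br v a) b = c *s br (br v b) a + br v (br a b)"
    and square_square: "a \<in> S \<Longrightarrow> br (br a a) (br a a) = 0"
    and nil: "a \<in> S \<Longrightarrow> \<exists>m. \<forall>v\<in>S. foldl br v (replicate m a) = 0"
begin

text \<open>The filtration that counts entries from \<open>H\<close>. The start \<open>w\<close>
  ranges over all of \<open>S\<close>, so leading factors of a word can be absorbed into it.\<close>

definition layer :: "'v set \<Rightarrow> nat \<Rightarrow> 'v set" where
  "layer H q = span {foldl br w hs | w hs. w \<in> S \<and> hs \<in> lists H \<and> length hs = q}"

lemma word_in_S: "v \<in> S \<Longrightarrow> xs \<in> lists S \<Longrightarrow> foldl br v xs \<in> S"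
  by (induction xs arbitrary: v) (auto intro: closed)

lemma layer_0: "layer H 0 = span S"
  unfolding layer_def by (rule arg_cong[where f=span]) auto

lemma word_in_layer: "w \<in> S \<Longrightarrow> hs \<in> lists H \<Longrightarrow> length hs = q \<Longrightarrow> foldl br w hs \<in> layer H q"
  unfolding layer_def by (rule span_base) auto

lemma layer_Suc:
  assumes "x \<in> layer H q" "h \<in> H"
  shows "br x h \<in> layer H (Suc q)"
proof (rule br_span_in_subspace)
  show "x \<in> span {foldl br w hs | w hs. w \<in> S \<and> hs \<in> lists H \<and> length hs = q}"
    using assms(1) by (simp add: layer_def)
  show "h \<in> span {h}" by (simp add: span_base)
  show "subspace (layer H (Suc q))" by (simp add: layer_def)
next
  fix a c assume "a \<in> {foldl br w hs | w hs. w \<in> S \<and> hs \<in> lists H \<and> length hs = q}" "c \<in> {h}"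
  then obtain w hs where "a = foldl br w hs" "w \<in> S" "hs \<in> lists H" "length hs = q" "c = h"
    by blast
  then show "br a c \<in> layer H (Suc q)"
    using word_in_layer[of w "hs @ [h]" H "Suc q"] assms(2) by simp
qed

text \<open>Brackets with \<open>s\<close> are moved to the left past those with \<open>H\<close>, whose number does not drop.\<close>

lemma layer_normalizer:
  assumes "s \<in> S" "H \<subseteq> S" "\<And>h. h \<in> H \<Longrightarrow> br h s \<in> H" "x \<in> layer H q"
  shows "br x s \<in> layer H q"
proof (rule br_span_in_subspace)
  show "x \<in> span {foldl br w hs | w hs. w \<in> S \<and> hs \<in> lists H \<and> length hs = q}"
    using assms(4) by (simp add: layer_def)
  show "s \<in> span {s}" by (simp add: span_base)
  show "subspace (layer H q)" by (simp add: layer_def)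
next
  have *: "br (foldl br w hs) s \<in> layer H (length hs)" if "w \<in> S" "hs \<in> lists H" for w hs
    using that(2)
  proof (induction hs rule: rev_induct)
    case Nil
    then show ?case using that(1) assms(1) by (simp add: layer_0 closed span_base)
  next
    case (snoc h hs)
    then have h: "h \<in> H" "h \<in> S" and hs: "hs \<in> lists H" using assms(2) by auto
    have "foldl br w hs \<in> S"
      using hs assms(2) that(1) by (intro word_in_S) auto
    with swap[OF h(2) assms(1)] obtain c where
      c: "br (br (foldl br w hs) h) s = c *s br (br (foldl br w hs) s) h + br (foldl br w hs) (br h s)"
      by blast
    have "br (br (foldl br w hs) s) h \<in> layer H (Suc (length hs))"
      using snoc.IH hs h(1) by (intro layer_Suc) auto
    moreover have "br (foldl br w hs) (br h s) \<in> layer H (Suc (length hs))"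
      using assms(3) h(1) hs that(1) by (intro layer_Suc word_in_layer) auto
    ultimately show ?case
      using c by (simp add: layer_def span_add span_scale)
  qed
  fix a c assume "a \<in> {foldl br w hs | w hs. w \<in> S \<and> hs \<in> lists H \<and> length hs = q}" "c \<in> {s}"
  then show "br a c \<in> layer H q" using * by auto
qed

text \<open>An entry \<open>s\<close> preserves each layer, and an entry from \<open>H\<close>
  raises the index by one. Only the first such gain is recorded, since layers decrease.\<close>

lemma word_layer:
  assumes "s \<in> S" "H \<subseteq> S" "\<And>h. h \<in> H \<Longrightarrow> br h s \<in> H" "x \<in> layer H q" "xs \<in> lists (insert s H)"
  shows "foldl br x xs \<in> layer H (if set xs \<subseteq> {s} then q else Suc q)"
  using assms(4,5)
proof (induction xs arbitrary: x rule: rev_induct)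
  case (snoc y xs)
  have IH: "foldl br x xs \<in> layer H (if set xs \<subseteq> {s} then q else Suc q)"
    using snoc by auto
  have norm: "br z s \<in> layer H p" if "z \<in> layer H p" for z p
    using layer_normalizer[of s H] assms(1-3) that by blast
  \<comment> \<open>Absorbing the first entry \<open>h\<close> into the start, as
    \<open>br w h\<close>, leaves one entry fewer.\<close>
  have sub: "layer H (Suc p) \<subseteq> layer H p" for p
    unfolding layer_def
  proof (rule span_mono, rule subsetI)
    fix z assume "z \<in> {foldl br w hs | w hs. w \<in> S \<and> hs \<in> lists H \<and> length hs = Suc p}"
    then obtain w hs' where "z = foldl br w hs'" "w \<in> S" "hs' \<in> lists H" "length hs' = Suc p"
      by blast
    moreover then obtain h hs where "hs' = h # hs" "h \<in> H" "hs \<in> lists H" "length hs = p"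
      by (cases hs') auto
    ultimately have "z = foldl br (br w h) hs" "w \<in> S" "h \<in> H" "hs \<in> lists H" "length hs = p"
      by auto
    moreover from this have "br w h \<in> S" using assms(2) closed by blast
    ultimately show "z \<in> {foldl br w hs | w hs. w \<in> S \<and> hs \<in> lists H \<and> length hs = p}"
      by blast
  qed
  show ?case
  proof (cases "y = s")
    case True
    then show ?thesis using IH norm by auto
  next
    case False
    then have "y \<in> H" using snoc.prems by auto
    then have "br (foldl br x xs) y \<in> layer H (Suc (if set xs \<subseteq> {s} then q else Suc q))"
      using IH layer_Suc by blast
    then show ?thesis using False sub by (auto split: if_splits)
  qed
qed auto

text \<open>The words start anywhere in \<open>S\<close>, not only in \<open>T\<close>: right
  multiplications by \<open>T\<close> generate a nilpotent algebra of operators on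
  \<open>span S\<close>. Products are only required to lie in \<open>span T\<close>, so that
  \<open>T\<close> can be an independent set.\<close>

definition nil_subset :: "'v set \<Rightarrow> bool" where
  "nil_subset T \<longleftrightarrow> T \<subseteq> S \<and> (\<forall>a\<in>T. \<forall>b\<in>T. br a b \<in> span T) \<and>
     (\<exists>n. \<forall>v\<in>S. \<forall>xs\<in>lists T. length xs = n \<longrightarrow> foldl br v xs = 0)"

text \<open>A word of length \<open>n * m\<close> splits into \<open>n\<close> blocks of length
  \<open>m\<close>, where \<open>m\<close> is the nil exponent of \<open>s\<close>. A block of
  \<open>s\<close> alone gives zero, and any other block raises the layer by one, up to layer
  \<open>n\<close>, which is zero.\<close>

lemma words_insert_vanish:
  assumes "s \<in> S" "H \<subseteq> S" "\<And>h. h \<in> H \<Longrightarrow> br h s \<in> H"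
    and N: "\<forall>v\<in>S. \<forall>xs\<in>lists H. length xs = n \<longrightarrow> foldl br v xs = 0"
  shows "\<exists>n. \<forall>v\<in>S. \<forall>xs\<in>lists (insert s H). length xs = n \<longrightarrow> foldl br v xs = 0"
proof -
  obtain m where m: "\<forall>v\<in>S. foldl br v (replicate m s) = 0"
    using nil[OF assms(1)] by blast
  \<comment> \<open>Every layer lies in \<open>span S\<close>, to which the vanishing of
    \<open>m\<close> multiplications by \<open>s\<close> extends by linearity.\<close>
  have m': "foldl br x (replicate m s) = 0" if "x \<in> layer H q" for x q
  proof (rule word_vanish_span[of S "{s}"])
    have "layer H q \<subseteq> span S"
      unfolding layer_def using assms(2) by (intro span_mono) (auto intro!: word_in_S)
    then show "x \<in> span S" using that by blast
    show "replicate m s \<in> lists (span {s})" by (auto simp: span_base)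
  next
    fix w ys assume "w \<in> S" "ys \<in> lists {s}" "length ys = length (replicate m s)"
    then have "ys = replicate m s"
      by (intro replicate_eqI) auto
    then show "foldl br w ys = 0" using m \<open>w \<in> S\<close> by simp
  qed
  have step: "foldl br x xs \<in> layer H (Suc q)"
    if "x \<in> layer H q" "xs \<in> lists (insert s H)" "length xs = m" for x xs q
  proof (cases "set xs \<subseteq> {s}")
    case True
    then have "xs = replicate m s" using that(3) by (intro replicate_eqI) auto
    then show ?thesis using m'[OF that(1)] by (simp add: layer_def span_zero)
  next
    case False
    have "foldl br x xs \<in> layer H (if set xs \<subseteq> {s} then q else Suc q)"
      using word_layer[of s H] assms(1-3) that(1,2) by blast
    with False show ?thesis by simp
  qed
  have "foldl br v xs \<in> layer H q"
    if "v \<in> S" "xs \<in> lists (insert s H)" "length xs = q * m" for v xs q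
    using that(2,3)
  proof (induction q arbitrary: xs)
    case 0
    then show ?case using that(1) by (simp add: layer_0 span_base)
  next
    case (Suc q)
    have "foldl br v (take (q * m) xs) \<in> layer H q"
      using Suc.prems by (intro Suc.IH) (auto dest: in_set_takeD)
    then have "foldl br (foldl br v (take (q * m) xs)) (drop (q * m) xs) \<in> layer H (Suc q)"
      using Suc.prems by (intro step) (auto dest: in_set_dropD)
    then show ?case by (simp flip: foldl_append)
  qed
  moreover have "layer H n \<subseteq> {0}"
    unfolding layer_def
    by (rule span_minimal) (use N in \<open>auto simp: subspace_single_0\<close>)
  ultimately show ?thesis by (intro exI[of _ "n * m"]) blast
qed

text \<open>If \<open>s\<close> is odd, \<open>br s s\<close> need not lie in \<open>span T\<close>, but then it can replace \<open>s\<close>: it still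
  normalizes \<open>span T\<close> and its own square is zero.\<close>

lemma normalizer_escapes:
  assumes T: "nil_subset T" and notin: "\<not> S \<subseteq> span T"
  shows "\<exists>s\<in>S. s \<notin> span T \<and> (\<forall>h\<in>S \<inter> span T. br s h \<in> span T) \<and> br s s \<in> span T"
proof -
  obtain n where n: "\<forall>v\<in>S. \<forall>xs\<in>lists T. length xs = n \<longrightarrow> foldl br v xs = 0"
    using T by (auto simp: nil_subset_def)
  have nH: "foldl br v xs = 0" if "v \<in> S" "xs \<in> lists (span T)" "length xs = n" for v xs
    using n that by (intro word_vanish_span[of S T xs v]) (auto simp: span_base)
  obtain s0 where s0: "s0 \<in> S" "s0 \<notin> span T" using notin by blast
  have "\<exists>s\<in>S. s \<notin> span T \<and> (\<forall>h\<in>S \<inter> span T. br s h \<in> span T)"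
  proof (rule ccontr)
    assume contra: "\<not> ?thesis"
    \<comment> \<open>If no element outside \<open>span T\<close> normalizes, each one is multiplied
      by some \<open>h\<close> to another one outside. Iterating from \<open>s0\<close> gives words
      of every length outside \<open>span T\<close>; at length \<open>n\<close> this contradicts
      their vanishing.\<close>
    have "\<exists>xs\<in>lists (S \<inter> span T). length xs = k \<and> foldl br s0 xs \<in> S - span T" for k
    proof (induction k)
      case 0
      show ?case using s0 by (intro bexI[of _ "[]"]) auto
    next
      case (Suc k)
      then obtain xs where xs: "xs \<in> lists (S \<inter> span T)" "length xs = k" "foldl br s0 xs \<in> S - span T"
        by blast
      then obtain h where "h \<in> S \<inter> span T" "br (foldl br s0 xs) h \<notin> span T"
        using contra by blast
      then show ?case using xs closed by (intro bexI[of _ "xs @ [h]"]) auto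
    qed
    then obtain xs where "xs \<in> lists (S \<inter> span T)" "length xs = n" "foldl br s0 xs \<notin> span T"
      by blast
    then show False using nH[OF s0(1), of xs] span_zero by auto
  qed
  then obtain s where s: "s \<in> S" "s \<notin> span T" and sH: "\<And>h. h \<in> S \<inter> span T \<Longrightarrow> br s h \<in> span T"
    by blast
  show ?thesis
  proof (cases "br s s \<in> span T")
    case True
    then show ?thesis using s sH by blast
  next
    case False
    have "br (br s s) h \<in> span T" if h: "h \<in> S \<inter> span T" for h
    proof -
      have h': "br s h \<in> S \<inter> span T" using sH h s closed by auto
      have s_h': "br s (br s h) \<in> span T" using sH h' by blast
      obtain c where "br (br s h) s = c *s br s (br s h)"
        using skew h' s(1) by blast
      then have "br (br s h) s \<in> span T" using s_h' by (simp add: span_scale)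
      \<comment> \<open>This is \<open>swap\<close> with start \<open>s\<close>: multiplying by
        \<open>br s s\<close> becomes two successive brackets of \<open>h\<close> with
        \<open>s\<close>, each of which stays in \<open>span T\<close>.\<close>
      moreover obtain d where "br (br s s) h = d *s br (br s h) s + br s (br s h)"
        using swap[of s h] s(1) h by blast
      ultimately show ?thesis using s_h' by (simp add: span_add span_scale)
    qed
    then show ?thesis
      using False s closed square_square[OF s(1)] span_zero by (intro bexI[of _ "br s s"]) auto
  qed
qed

text \<open>Counting layers requires a subset of \<open>S\<close> stable under bracketing with
  \<open>s\<close>. The set \<open>T\<close> itself may fail this, but
  \<open>S \<inter> span T\<close> is stable and still has vanishing words of length
  \<open>n\<close>.\<close>

lemma nil_subset_insert:
  assumes T: "nil_subset T" and s: "s \<in> S" "\<forall>h\<in>S \<inter> span T. br s h \<in> span T" "br s s \<in> span T"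
  shows "nil_subset (insert s T)"
proof -
  define H where "H = S \<inter> span T"
  obtain n where n: "\<forall>v\<in>S. \<forall>xs\<in>lists T. length xs = n \<longrightarrow> foldl br v xs = 0"
    using T by (auto simp: nil_subset_def)
  have TH: "T \<subseteq> H" using T span_superset unfolding nil_subset_def H_def by blast
  have nH: "\<forall>v\<in>S. \<forall>xs\<in>lists H. length xs = n \<longrightarrow> foldl br v xs = 0"
  proof (intro ballI impI)
    fix v xs assume "v \<in> S" "xs \<in> lists H" "length xs = n"
    then show "foldl br v xs = 0"
      using n by (intro word_vanish_span[of S T xs v]) (auto simp: span_base H_def)
  qed
  have Hs: "br h s \<in> H" if "h \<in> H" for h
  proof -
    have h: "h \<in> S" "h \<in> S \<inter> span T" using that by (auto simp: H_def)
    obtain c where "br h s = c *s br s h" using skew[OF h(1) s(1)] by blast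
    moreover have "br s h \<in> span T" using s(2) h(2) by blast
    ultimately show ?thesis using closed[OF h(1) s(1)] by (simp add: span_scale H_def)
  qed
  have "H \<subseteq> S" by (auto simp: H_def)
  obtain m where m: "\<forall>v\<in>S. \<forall>xs\<in>lists (insert s H). length xs = m \<longrightarrow> foldl br v xs = 0"
    using words_insert_vanish[OF s(1) \<open>H \<subseteq> S\<close> _ nH] Hs by blast
  have sub: "span T \<subseteq> span (insert s T)" by (rule span_mono) auto
  have "br a b \<in> span T" if "a \<in> insert s T" "b \<in> insert s T" for a b
    using that T s Hs TH unfolding nil_subset_def H_def by blast
  then have prod: "\<forall>a\<in>insert s T. \<forall>b\<in>insert s T. br a b \<in> span (insert s T)"
    using sub by blast
  show ?thesis
    unfolding nil_subset_def
  proof (intro conjI prod)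
    show "insert s T \<subseteq> S" using T s(1) unfolding nil_subset_def by blast
    show "\<exists>n. \<forall>v\<in>S. \<forall>xs\<in>lists (insert s T). length xs = n \<longrightarrow> foldl br v xs = 0"
      using m lists_mono[of "insert s T" "insert s H"] TH by (intro exI[of _ m]) blast
  qed
qed

text \<open>Independent nil subsets have at most \<open>card F\<close> elements, so one of maximal
  cardinality exists. It must span \<open>S\<close>, since otherwise a normalizing element could be
  adjoined.\<close>

theorem engel:
  "\<exists>n. \<forall>v\<in>span S. \<forall>xs\<in>lists (span S). length xs = n \<longrightarrow> foldl br v xs = 0"
proof -
  let ?P = "\<lambda>T. nil_subset T \<and> independent T"
  have bound: "finite T \<and> card T \<le> card F" if "?P T" for T
    using that S_sub finite_F by (intro independent_span_bound) (auto simp: nil_subset_def)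
  have "nil_subset {}"
    \<comment> \<open>Length 1 makes the condition vacuous: the only word over the empty set has
      length 0.\<close>
    unfolding nil_subset_def by (auto intro!: exI[of _ 1])
  then have "?P {}" by (simp add: independent_empty)
  then obtain T where T: "?P T" and max: "\<And>T'. ?P T' \<Longrightarrow> card T' \<le> card T"
    using ex_has_greatest_nat[of ?P "{}" card "Suc (card F)"] bound less_Suc_eq_le by blast
  have "S \<subseteq> span T"
  proof (rule ccontr)
    assume "\<not> S \<subseteq> span T"
    then obtain s where s: "s \<in> S" "s \<notin> span T" "\<forall>h\<in>S \<inter> span T. br s h \<in> span T" "br s s \<in> span T"
      using normalizer_escapes T by blast
    then have "?P (insert s T)"
      using T nil_subset_insert independent_insertI by blast
    moreover have "card (insert s T) = Suc (card T)"
      using bound[OF T] s(2) span_base by (auto simp: card_insert_if)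
    ultimately show False using max by fastforce
  qed
  then have sub: "span S \<subseteq> span T" by (simp add: span_minimal)
  obtain n where n: "\<forall>v\<in>S. \<forall>xs\<in>lists T. length xs = n \<longrightarrow> foldl br v xs = 0"
    using T by (auto simp: nil_subset_def)
  have "foldl br v xs = 0" if "v \<in> span S" "xs \<in> lists (span S)" "length xs = n" for v xs
    using n that sub by (intro word_vanish_span[of S T xs v]) auto
  then show ?thesis by blast
qed

end

subsection \<open>Generalized eigenvectors\<close>

locale linear_operator = vector_space scale
  for scale :: "'k::field \<Rightarrow> 'v::ab_group_add \<Rightarrow> 'v"  (infixr \<open>*s\<close> 75) +
  fixes D :: "'v \<Rightarrow> 'v"
  assumes D_add: "D (x + y) = D x + D y"
    and D_scale: "D (c *s x) = c *s D x"
begin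

lemma D_zero [simp]: "D 0 = 0"
  using D_scale[of 0 0] by simp

lemma D_sum: "D (\<Sum>i\<in>I. f i) = (\<Sum>i\<in>I. D (f i))"
  by (induction I rule: infinite_finite_induct) (auto simp: D_add)

lemma D_diff: "D (x - y) = D x - D y"
  using D_add[of "x - y" y] by (simp add: algebra_simps)

section \<open>Polynomials in a linear operator\<close>

definition poly_op :: "'k poly \<Rightarrow> 'v \<Rightarrow> 'v" where
  "poly_op p v = (\<Sum>i\<le>degree p. coeff p i *s (D ^^ i) v)"

lemma poly_op_eq: "degree p \<le> n \<Longrightarrow> poly_op p v = (\<Sum>i\<le>n. coeff p i *s (D ^^ i) v)"
  unfolding poly_op_def by (rule sum.mono_neutral_left) (auto simp: coeff_eq_0)

lemma poly_op_0 [simp]: "poly_op 0 v = 0"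
  by (simp add: poly_op_def)

lemma poly_op_pCons: "poly_op (pCons a p) v = a *s v + D (poly_op p v)"
proof -
  have "poly_op (pCons a p) v = (\<Sum>i\<le>Suc (degree p). coeff (pCons a p) i *s (D ^^ i) v)"
    by (rule poly_op_eq) (rule degree_pCons_le)
  also have "\<dots> = a *s v + (\<Sum>i\<le>degree p. coeff p i *s (D ^^ Suc i) v)"
    by (subst sum.atMost_Suc_shift) simp
  also have "\<dots> = a *s v + D (poly_op p v)"
    by (simp add: poly_op_def D_sum D_scale)
  finally show ?thesis .
qed

lemma poly_op_add: "poly_op (p + q) v = poly_op p v + poly_op q v"
proof -
  define n where "n = max (degree p) (degree q)"
  have "degree (p + q) \<le> n" "degree p \<le> n" "degree q \<le> n"
    by (auto simp: n_def degree_add_le_max)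
  then show ?thesis
    by (simp add: poly_op_eq[of _ n] scale_left_distrib sum.distrib)
qed

lemma poly_op_smult: "poly_op (smult c p) v = c *s poly_op p v"
  by (simp add: poly_op_eq[of _ "degree p"] degree_smult_le scale_sum_right)

lemma poly_op_mult: "poly_op (p * q) v = poly_op p (poly_op q v)"
  by (induction p) (simp_all add: poly_op_pCons poly_op_add poly_op_smult)

lemma poly_op_sum: "poly_op (\<Sum>i\<in>I. p i) v = (\<Sum>i\<in>I. poly_op (p i) v)"
  by (induction I rule: infinite_finite_induct) (auto simp: poly_op_add)

lemma poly_op_monom: "poly_op (monom c n) v = c *s (D ^^ n) v"
proof (induction n)
  case 0
  then show ?case by (simp add: monom_0 poly_op_pCons)
next
  case (Suc n)
  then show ?case by (simp add: monom_Suc poly_op_pCons D_scale)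
qed

lemma poly_op_arg_add: "poly_op p (x + y) = poly_op p x + poly_op p y"
  by (induction p) (simp_all add: poly_op_pCons D_add scale_right_distrib)

lemma poly_op_arg_scale: "poly_op p (c *s x) = c *s poly_op p x"
  by (induction p) (simp_all add: poly_op_pCons D_scale scale_right_distrib mult.commute)

lemma poly_op_arg_zero [simp]: "poly_op p 0 = 0"
  using poly_op_arg_scale[of p 0 0] by simp

lemma poly_op_eigenvector: "D e = l *s e \<Longrightarrow> poly_op p e = poly p l *s e"
  by (induction p) (simp_all add: poly_op_pCons D_scale scale_left_distrib mult.commute)

section \<open>Shifted operators and their generalized kernels\<close>

definition shift :: "'k \<Rightarrow> 'v \<Rightarrow> 'v" where
  "shift l x = D x - l *s x"

lemma shift_pow_add: "(shift l ^^ n) (x + y) = (shift l ^^ n) x + (shift l ^^ n) y"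
  by (induction n) (simp_all add: shift_def D_add scale_right_distrib)

lemma shift_pow_scale: "(shift l ^^ n) (c *s x) = c *s (shift l ^^ n) x"
  by (induction n) (simp_all add: shift_def D_scale scale_right_diff_distrib mult.commute)

lemma shift_pow_zero [simp]: "(shift l ^^ n) 0 = 0"
  using shift_pow_scale[of n l 0 0] by simp

lemma shift_zero [simp]: "shift l 0 = 0"
  by (simp add: shift_def)

lemma shift_pow_mono: "(shift l ^^ m) x = 0 \<Longrightarrow> m \<le> n \<Longrightarrow> (shift l ^^ n) x = 0"
  by (metis comp_apply funpow_add le_add_diff_inverse2 shift_pow_zero)

lemma shift_in: "subspace G \<Longrightarrow> D ` G \<subseteq> G \<Longrightarrow> x \<in> G \<Longrightarrow> shift l x \<in> G"
  unfolding shift_def by (auto intro!: subspace_diff subspace_scale)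

text \<open>On the generalized eigenspace for \<open>m\<close>, the operator \<open>shift l\<close>
  is the nonzero scalar \<open>m - l\<close> plus the nilpotent \<open>shift m\<close>, hence
  invertible there.\<close>

lemma shift_pow_solve:
  assumes "subspace G" "D ` G \<subseteq> G" "m \<noteq> l" "w \<in> G" "(shift m ^^ n) w = 0"
  shows "\<exists>u\<in>G. (shift m ^^ n) u = 0 \<and> shift l u = w"
  using assms(4,5)
proof (induction n arbitrary: w)
  case 0
  then show ?case by (intro bexI[of _ 0]) (auto simp: shift_def)
next
  case (Suc n)
  have "(shift m ^^ n) (shift m w) = 0" using Suc.prems(2) by (simp add: funpow_swap1)
  then obtain u where u: "u \<in> G" "(shift m ^^ n) u = 0" "shift l u = shift m w"
    using Suc.IH[of "shift m w"] shift_in[OF assms(1,2) Suc.prems(1)] by blast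
  \<comment> \<open>As \<open>shift l w - shift m w\<close> is \<open>(m - l) *s w\<close>,
    subtracting the solution \<open>u\<close> for \<open>shift m w\<close> from \<open>w\<close>
    solves the equation up to the factor \<open>m - l\<close>.\<close>
  define u' where "u' = inverse (m - l) *s (w - u)"
  have "u' \<in> G"
    using assms(1) u(1) Suc.prems(1) by (auto simp: u'_def intro!: subspace_scale subspace_diff)
  moreover have "(shift m ^^ Suc n) u = 0"
    using u(2) by (rule shift_pow_mono) simp
  then have "(shift m ^^ Suc n) u' = 0"
    using Suc.prems(2) shift_pow_add[of "Suc n" m "w - u" u] by (simp add: u'_def shift_pow_scale del: funpow.simps)
  moreover have "shift l (w - u) = (m - l) *s w"
    using u(3) by (simp add: shift_def D_diff algebra_simps scale_right_diff_distrib scale_left_diff_distrib)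
  then have "shift l u' = w"
    using assms(3) shift_pow_scale[of 1 l] by (simp add: u'_def)
  ultimately show ?case by blast
qed

definition gen_eigenvectors :: "'v set \<Rightarrow> 'v set" where
  "gen_eigenvectors G = {x \<in> G. \<exists>l n. (shift l ^^ n) x = 0}"

text \<open>The components of \<open>shift l v\<close> for eigenvalues other than \<open>l\<close>
  have preimages under \<open>shift l\<close> in the span. Subtracting these from \<open>v\<close>
  leaves a generalized eigenvector for \<open>l\<close>.\<close>

lemma shift_in_span_gen_eigenvectors:
  assumes G: "subspace G" "D ` G \<subseteq> G" and v: "v \<in> G" "shift l v \<in> span (gen_eigenvectors G)"
  shows "v \<in> span (gen_eigenvectors G)"
proof -
  let ?E = "gen_eigenvectors G"
  \<comment> \<open>Modulo the image of \<open>span ?E\<close> under \<open>shift l\<close>, only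
    the part belonging to \<open>l\<close> survives.\<close>
  have "\<exists>u\<in>span ?E. \<exists>n. (shift l ^^ n) (w - shift l u) = 0" if "w \<in> span ?E" for w
    using that
  proof (induction rule: span_induct_alt)
    case base
    show ?case by (intro bexI[of _ 0]) (auto simp: span_zero)
  next
    case (step c x y)
    then obtain u n where u: "u \<in> span ?E" "(shift l ^^ n) (y - shift l u) = 0" by blast
    obtain m k where x: "x \<in> G" "(shift m ^^ k) x = 0"
      using step(1) by (auto simp: gen_eigenvectors_def)
    show ?case
    proof (cases "m = l")
      case True
      have "(shift l ^^ max n k) (c *s x + (y - shift l u)) = 0"
        using shift_pow_mono[OF u(2), of "max n k"] shift_pow_mono[OF x(2), of "max n k"] True
        by (simp add: shift_pow_add shift_pow_scale)
      then show ?thesis using u(1) by (intro bexI[of _ u] exI[of _ "max n k"]) (auto simp: algebra_simps)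
    next
      case False
      then obtain z where z: "z \<in> G" "(shift m ^^ k) z = 0" "shift l z = x"
        using shift_pow_solve[OF G _ x] by blast
      then have "z \<in> span ?E" by (auto simp: gen_eigenvectors_def intro!: span_base)
      have "c *s x + y - shift l (c *s z + u) = y - shift l u"
        using z(3) by (simp add: shift_def D_add D_scale algebra_simps scale_right_distrib scale_right_diff_distrib mult.commute)
      then have "(shift l ^^ n) (c *s x + y - shift l (c *s z + u)) = 0"
        using u(2) by (simp only:)
      moreover have "c *s z + u \<in> span ?E"
        using \<open>z \<in> span ?E\<close> u(1) by (intro span_add span_scale)
      ultimately show ?thesis by blast
    qed
  qed
  then obtain u n where u: "u \<in> span ?E" "(shift l ^^ n) (shift l v - shift l u) = 0"
    using v(2) by blast
  have "span ?E \<subseteq> G" by (rule span_minimal) (use G(1) in \<open>auto simp: gen_eigenvectors_def\<close>)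
  then have "v - u \<in> G" using u(1) v(1) G(1) by (auto intro: subspace_diff)
  moreover have "shift l (v - u) = shift l v - shift l u"
    by (simp add: shift_def D_diff algebra_simps scale_right_diff_distrib)
  then have "(shift l ^^ Suc n) (v - u) = 0"
    using u(2) by (simp add: funpow_swap1)
  ultimately have "v - u \<in> ?E" unfolding gen_eigenvectors_def by blast
  then have "(v - u) + u \<in> span ?E" using u(1) span_add span_base by blast
  then show ?thesis by simp
qed

text \<open>The iterates of \<open>v\<close> with exponents 0 to \<open>card F\<close> are one too
  many to be independent in \<open>span F\<close>; a linear relation among them is the
  polynomial.\<close>

lemma annihilating_poly_exists:
  assumes "finite F" "\<And>i. (D ^^ i) v \<in> span F"
  shows "\<exists>p. p \<noteq> 0 \<and> poly_op p v = 0"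
\<comment> \<open>Dependence is a property of the set of iterates, so coinciding iterates are
  treated separately, by a difference of two monomials.\<close>
proof (cases "inj_on (\<lambda>i. (D ^^ i) v) {..card F}")
  case True
  define A where "A = (\<lambda>i. (D ^^ i) v) ` {..card F}"
  have "card A = Suc (card F)" using True by (simp add: A_def card_image)
  moreover have "A \<subseteq> span F" using assms(2) by (auto simp: A_def)
  ultimately have "dependent A"
    using independent_span_bound[OF assms(1), of A] by fastforce
  moreover have "finite A" by (simp add: A_def)
  ultimately obtain u a where u: "(\<Sum>v\<in>A. u v *s v) = 0" and a: "a \<in> A" "u a \<noteq> 0"
    by (auto simp: dependent_finite)
  define p where "p = (\<Sum>i\<le>card F. monom (u ((D ^^ i) v)) i)"
  obtain j where j: "j \<le> card F" "a = (D ^^ j) v" using a(1) by (auto simp: A_def)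
  have "coeff p j = u a"
    using j by (simp add: p_def coeff_sum)
  then have "p \<noteq> 0" using a(2) by auto
  moreover have "poly_op p v = (\<Sum>v\<in>A. u v *s v)"
    unfolding p_def A_def by (simp add: sum.reindex[OF True] poly_op_sum poly_op_monom)
  ultimately show ?thesis using u by auto
next
  case False
  then obtain i j where ij: "i \<noteq> j" "(D ^^ i) v = (D ^^ j) v" by (auto simp: inj_on_def)
  define p :: "'k poly" where "p = monom 1 i + monom (- 1) j"
  have "coeff p i = 1" using ij(1) by (simp add: p_def)
  then have "p \<noteq> 0" by auto
  moreover have "poly_op p v = 0" using ij(2) by (simp add: p_def poly_op_add poly_op_monom)
  ultimately show ?thesis by blast
qed

text \<open>The product of annihilating polynomials of the generators annihilates
  \<open>span F\<close>, and every eigenvalue is one of its roots.\<close>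

lemma finite_eigenvalues:
  assumes "finite F" "D ` span F \<subseteq> span F"
  shows "finite {l. \<exists>x\<in>span F. x \<noteq> 0 \<and> (\<exists>n. (shift l ^^ n) x = 0)}"
proof -
  have "(D ^^ i) v \<in> span F" if "v \<in> span F" for v i
    using that assms(2) by (induction i) auto
  then have "\<forall>f\<in>F. \<exists>p. p \<noteq> 0 \<and> poly_op p f = 0"
    using annihilating_poly_exists[OF assms(1)] span_base by blast
  then obtain P where P: "\<And>f. f \<in> F \<Longrightarrow> P f \<noteq> 0" "\<And>f. f \<in> F \<Longrightarrow> poly_op (P f) f = 0"
    by metis
  define Q where "Q = prod P F"
  have "Q \<noteq> 0" using P(1) assms(1) by (simp add: Q_def)
  have QF: "poly_op Q f = 0" if "f \<in> F" for f
  proof -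
    have "Q = prod P (F - {f}) * P f"
      using that assms(1) by (simp add: Q_def prod.remove mult.commute)
    then show ?thesis using P(2)[OF that] by (simp add: poly_op_mult)
  qed
  have Q: "poly_op Q x = 0" if "x \<in> span F" for x
    using that
  proof (rule span_induct)
    show "subspace {x. poly_op Q x = 0}"
      by (auto simp: subspace_def poly_op_arg_add poly_op_arg_scale)
  qed (use QF in auto)
  \<comment> \<open>The last nonzero iterate of \<open>shift l\<close> on \<open>x\<close> is a
    genuine eigenvector.\<close>
  have eig: "\<exists>e\<in>span F. e \<noteq> 0 \<and> D e = l *s e"
    if "x \<in> span F" "x \<noteq> 0" "(shift l ^^ n) x = 0" for x l n
    using that
  proof (induction n arbitrary: x)
    case (Suc n)
    show ?case
    proof (cases "shift l x = 0")
      case True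
      then show ?thesis using Suc.prems by (auto simp: shift_def)
    next
      case False
      moreover have "shift l x \<in> span F"
        using shift_in[OF subspace_span assms(2) Suc.prems(1)] .
      ultimately show ?thesis using Suc.IH[of "shift l x"] Suc.prems(3) by (simp add: funpow_swap1)
    qed
  qed simp
  have "{l. \<exists>x\<in>span F. x \<noteq> 0 \<and> (\<exists>n. (shift l ^^ n) x = 0)} \<subseteq> {l. poly Q l = 0}"
  proof safe
    fix l x n assume "x \<in> span F" "x \<noteq> 0" "(shift l ^^ n) x = 0"
    then obtain e where e: "e \<in> span F" "e \<noteq> 0" "D e = l *s e" using eig by blast
    then show "poly Q l = 0" using Q[OF e(1)] poly_op_eigenvector[OF e(3), of Q] by auto
  qed
  then show ?thesis using poly_roots_finite[OF \<open>Q \<noteq> 0\<close>] finite_subset by blast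
qed

end

section \<open>Generalized eigenvectors over an algebraically closed field\<close>

locale linear_operator_alg_closed = linear_operator scale D
  for scale :: "'k::alg_closed_field \<Rightarrow> 'v::ab_group_add \<Rightarrow> 'v"  (infixr \<open>*s\<close> 75) and D
begin

text \<open>Splitting off a root \<open>l\<close> of \<open>p\<close> leaves a factor of smaller
  degree that annihilates \<open>shift l v\<close>; from there \<open>v\<close> itself is
  recovered.\<close>

lemma annihilated_in_span_gen_eigenvectors:
  assumes "subspace G" "D ` G \<subseteq> G" "v \<in> G" "p \<noteq> 0" "poly_op p v = 0"
  shows "v \<in> span (gen_eigenvectors G)"
  using assms(3-5)
proof (induction "degree p" arbitrary: p v)
  case 0
  then obtain c where "p = [:c:]" "c \<noteq> 0" by (metis degree_eq_zeroE pCons_0_0)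
  then have "v = 0" using 0 by (simp add: poly_op_pCons)
  then show ?case by (simp add: span_zero)
next
  case (Suc n)
  then obtain l where "poly p l = 0" using alg_closed_imp_poly_has_root[of p] by auto
  then obtain q where q: "p = q * [:- l, 1:]"
    by (metis dvdE mult.commute poly_eq_0_iff_dvd)
  have "q \<noteq> 0" using q Suc.prems by auto
  moreover have "n = degree q"
    using Suc.hyps(2) degree_mult_eq[of q "[:- l, 1:]"] \<open>q \<noteq> 0\<close> q by (simp del: mult_pCons_right)
  moreover have "poly_op [:- l, 1:] v = shift l v"
    by (simp add: poly_op_pCons shift_def)
  then have "poly_op q (shift l v) = 0"
    using Suc.prems(3) poly_op_mult[of q "[:- l, 1:]" v] unfolding q by metis
  ultimately have "shift l v \<in> span (gen_eigenvectors G)"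
    using Suc.hyps(1) shift_in[OF assms(1,2) Suc.prems(1)] by blast
  then show ?case by (rule shift_in_span_gen_eigenvectors[OF assms(1,2) Suc.prems(1)])
qed

lemma gen_eigenvectors_span:
  assumes "subspace G" "D ` G \<subseteq> G" "finite F" "G \<subseteq> span F"
  shows "G \<subseteq> span (gen_eigenvectors G)"
proof
  fix v assume v: "v \<in> G"
  have "(D ^^ i) v \<in> G" for i
    using v assms(2) by (induction i) auto
  then obtain p where "p \<noteq> 0" "poly_op p v = 0"
    using annihilating_poly_exists[OF assms(3), of v] assms(4) by blast
  then show "v \<in> span (gen_eigenvectors G)"
    using annihilated_in_span_gen_eigenvectors[OF assms(1,2) v] by blast
qed

end

text \<open>The algebra meant is \<open>span F\<close> inside a larger type. Injectivity of
  \<open>D\<close> is asked only there: the scalar extension lives in a full function space, where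
  the extended operator kills all functions vanishing on the basis.\<close>

locale graded_derivation = bilinear_algebra scale br + linear_operator_alg_closed scale D
  for scale :: "'k::{alg_closed_field,field_char_0} \<Rightarrow> 'v::ab_group_add \<Rightarrow> 'v"  (infixr \<open>*s\<close> 75)
    and br and D +
  fixes G :: "bit \<Rightarrow> 'v set" and F :: "'v set"
  assumes subspace_G: "subspace (G i)"
    and finite_F: "finite F"
    and G_sub: "G i \<subseteq> span F"
    and F_sub: "F \<subseteq> span (G 0 \<union> G 1)"
    and D_G: "D ` G i \<subseteq> G i"
    and D_inj: "x \<in> span F \<Longrightarrow> D x = 0 \<Longrightarrow> x = 0"
    and D_br: "D (br x y) = br (D x) y + br x (D y)"
    and br_G: "a \<in> G i \<Longrightarrow> b \<in> G j \<Longrightarrow> br a b \<in> G (i + j)"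
    and br_skew: "a \<in> G i \<Longrightarrow> b \<in> G j \<Longrightarrow> br a b = - (koszul_sign i j *s br b a)"
    and br_swap: "a \<in> G i \<Longrightarrow> b \<in> G j \<Longrightarrow> v \<in> span F \<Longrightarrow>
      br (br v a) b = koszul_sign i j *s br (br v b) a + br v (br a b)"
begin

section \<open>Brackets of generalized eigenvectors of a derivation\<close>

lemma shift_br: "shift (l + m) (br x y) = br (shift l x) y + br x (shift m y)"
proof -
  have "br (a - b) c = br a c - br b c" "br c (a - b) = br c a - br c b" for a b c
    using br_add_left[of "a - b" b c] br_add_right[of c "a - b" b] by (simp_all add: algebra_simps)
  then show ?thesis
    by (simp add: shift_def D_br br_scale_left br_scale_right scale_left_distrib)
qed

text \<open>By the Leibniz rule, each term in the expansion of the power \<open>i + j\<close>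
  applies \<open>shift l\<close> at least \<open>i\<close> times to \<open>x\<close> or
  \<open>shift m\<close> at least \<open>j\<close> times to \<open>y\<close>.\<close>

lemma shift_pow_br:
  "(shift l ^^ i) x = 0 \<Longrightarrow> (shift m ^^ j) y = 0 \<Longrightarrow> (shift (l + m) ^^ (i + j)) (br x y) = 0"
proof (induction "i + j" arbitrary: i j x y)
  case 0
  then show ?case by simp
next
  case (Suc n)
  show ?case
  proof (cases "i = 0 \<or> j = 0")
    case True
    then show ?thesis using Suc.prems by auto
  next
    case False
    then obtain i' j' where ij: "i = Suc i'" "j = Suc j'" by (meson not0_implies_Suc)
    have n: "n = i' + j" "n = i + j'" using Suc.hyps(2) ij by auto
    have "(shift l ^^ i') (shift l x) = 0" "(shift m ^^ j') (shift m y) = 0"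
      using Suc.prems ij by (simp_all add: funpow_swap1)
    then have "(shift (l + m) ^^ n) (br (shift l x) y) = 0" "(shift (l + m) ^^ n) (br x (shift m y)) = 0"
      using Suc.hyps(1)[OF n(1)] Suc.hyps(1)[OF n(2)] Suc.prems n by auto
    moreover have "(shift (l + m) ^^ (i + j)) (br x y) = (shift (l + m) ^^ n) (shift (l + m) (br x y))"
      by (simp add: Suc.hyps(2)[symmetric] funpow_swap1)
    ultimately show ?thesis by (simp add: shift_br shift_pow_add)
  qed
qed

text \<open>Its elements are homogeneous as well, since the scalars in \<open>skew\<close> and
  \<open>swap\<close> depend on the degrees.\<close>

definition S :: "'v set" where
  "S = (\<Union>i. gen_eigenvectors (G i))"

lemma S_I: "x \<in> G i \<Longrightarrow> (shift l ^^ n) x = 0 \<Longrightarrow> x \<in> S"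
  by (auto simp: S_def gen_eigenvectors_def)

lemma S_E:
  assumes "x \<in> S"
  obtains i l n where "x \<in> G i" "(shift l ^^ n) x = 0" "x \<in> span F"
  using assms G_sub by (fastforce simp: S_def gen_eigenvectors_def)

lemma D_span_F: "D ` span F \<subseteq> span F"
proof safe
  have "span F \<subseteq> span (G 0 \<union> G 1)"
    using F_sub by (simp add: span_minimal)
  moreover fix x assume "x \<in> span F"
  ultimately have "x \<in> span (G 0 \<union> G 1)" by blast
  then show "D x \<in> span F"
  proof (rule span_induct)
    show "subspace {x. D x \<in> span F}"
      by (auto simp: subspace_def D_add D_scale span_zero span_add span_scale)
  qed (use D_G G_sub in blast)
qed

lemma span_S: "span F \<subseteq> span S"
proof -
  have "G i \<subseteq> span S" for i
    using gen_eigenvectors_span[OF subspace_G D_G finite_F G_sub, of i]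
      span_mono[of "gen_eigenvectors (G i)" S] by (auto simp: S_def)
  then have "span (G 0 \<union> G 1) \<subseteq> span S" by (simp add: span_minimal)
  then show ?thesis using F_sub by (meson order.trans span_minimal subspace_span)
qed

text \<open>Bracketing with an \<open>l\<close>-eigenvector shifts eigenvalues by \<open>l \<noteq> 0\<close>, and there are
  finitely many eigenvalues; this is where characteristic zero enters.\<close>

lemma nil_S:
  assumes a: "a \<in> S"
  shows "\<exists>m. \<forall>v\<in>S. foldl br v (replicate m a) = 0"
proof (cases "a = 0")
  case True
  then show ?thesis by (intro exI[of _ 1]) simp
next
  case False
  obtain l n where l: "(shift l ^^ n) a = 0" "a \<in> span F" using a by (rule S_E)
  \<comment> \<open>Eigenvalue zero would give \<open>(D ^^ n) a = 0\<close> with \<open>a\<close>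
    nonzero, against injectivity of \<open>D\<close> on \<open>span F\<close>.\<close>
  have "l \<noteq> 0"
  proof
    assume "l = 0"
    have "(D ^^ n) a = 0" using l by (simp add: \<open>l = 0\<close> shift_def[abs_def])
    moreover have "(D ^^ k) a \<noteq> 0 \<and> (D ^^ k) a \<in> span F" for k
      using False l(2) D_inj D_span_F by (induction k) auto
    ultimately show False by blast
  qed
  define L where "L = {l. \<exists>x\<in>span F. x \<noteq> 0 \<and> (\<exists>n. (shift l ^^ n) x = 0)}"
  have "finite L" unfolding L_def by (rule finite_eigenvalues[OF finite_F D_span_F])
  have "foldl br v (replicate (card L) a) = 0" if v: "v \<in> S" for v
  proof (rule ccontr)
    let ?v = "\<lambda>k. foldl br v (replicate k a)"
    \<comment> \<open>If this product is nonzero, so are all shorter ones. Together with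
      \<open>v\<close> they give \<open>card L + 1\<close> distinct eigenvalues
      \<open>m + of_nat k * l\<close>, all in \<open>L\<close>.\<close>
    assume nz: "?v (card L) \<noteq> 0"
    obtain m j where m: "(shift m ^^ j) v = 0" using v by (rule S_E)
    have Suc: "?v (Suc k) = br (?v k) a" for k
      by (simp flip: replicate_append_same)
    have eig: "?v k \<in> S \<and> (shift (m + of_nat k * l) ^^ (j + k * n)) (?v k) = 0" for k
    proof (induction k)
      case 0
      then show ?case using v m by simp
    next
      case (Suc k)
      have "(shift (m + of_nat k * l + l) ^^ (j + k * n + n)) (br (?v k) a) = 0"
        using Suc.IH l(1) by (intro shift_pow_br) auto
      then have *: "(shift (m + of_nat (Suc k) * l) ^^ (j + Suc k * n)) (?v (Suc k)) = 0"
        by (simp add: \<open>?v (Suc k) = br (?v k) a\<close> algebra_simps del: replicate_Suc)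
      obtain x y where "?v k \<in> G x" "a \<in> G y"
        using Suc.IH a by (meson S_E)
      then have "?v (Suc k) \<in> G (x + y)" unfolding \<open>?v (Suc k) = br (?v k) a\<close> by (rule br_G)
      then show ?case using * S_I by blast
    qed
    have nz': "?v k \<noteq> 0" if "k \<le> card L" for k
    proof
      assume "?v k = 0"
      moreover have "replicate (card L) a = replicate k a @ replicate (card L - k) a"
        using that by (simp flip: replicate_add)
      ultimately show False using nz by simp
    qed
    have "(\<lambda>k. m + of_nat k * l) ` {..card L} \<subseteq> L"
    proof (rule image_subsetI)
      fix k assume "k \<in> {..card L}"
      then have "?v k \<noteq> 0" using nz' by simp
      moreover have "?v k \<in> span F" using eig[of k] by (blast elim: S_E)
      ultimately show "m + of_nat k * l \<in> L"
        unfolding L_def using eig[of k]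
        by (intro CollectI bexI[of _ "?v k"] conjI exI[of _ "j + k * n"]) simp_all
    qed
    moreover have "inj_on (\<lambda>k. m + of_nat k * l) {..card L}"
      using \<open>l \<noteq> 0\<close> by (auto simp: inj_on_def)
    ultimately have "card {..card L} \<le> card L"
      using \<open>finite L\<close> card_inj_on_le by blast
    then show False by simp
  qed
  then show ?thesis by blast
qed

sublocale weakly_closed scale br S F
proof
  show "finite F" by (rule finite_F)
  show "S \<subseteq> span F" by (auto elim: S_E)
  show "br a b \<in> S" if "a \<in> S" "b \<in> S" for a b
  proof -
    obtain x l i y m j where "a \<in> G x" "(shift l ^^ i) a = 0" "b \<in> G y" "(shift m ^^ j) b = 0"
      using \<open>a \<in> S\<close> \<open>b \<in> S\<close> by (meson S_E)
    then show ?thesis using br_G shift_pow_br S_I by blast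
  qed
  show "\<exists>c. br a b = c *s br b a" if "a \<in> S" "b \<in> S" for a b
  proof -
    obtain x y where "a \<in> G x" "b \<in> G y" using \<open>a \<in> S\<close> \<open>b \<in> S\<close> by (meson S_E)
    then have "br a b = (- koszul_sign x y) *s br b a" by (simp add: br_skew[of a x b y])
    then show ?thesis by blast
  qed
  show "\<exists>c. \<forall>v\<in>S. br (br v a) b = c *s br (br v b) a + br v (br a b)" if "a \<in> S" "b \<in> S" for a b
  proof -
    obtain x y where "a \<in> G x" "b \<in> G y" using \<open>a \<in> S\<close> \<open>b \<in> S\<close> by (meson S_E)
    then show ?thesis using br_swap by (blast elim: S_E)
  qed
  show "br (br a a) (br a a) = 0" if "a \<in> S" for a
  proof -
    obtain x where "a \<in> G x" using \<open>a \<in> S\<close> by (rule S_E)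
    \<comment> \<open>A square is even whatever the degree of \<open>a\<close>, so skew-symmetry
      makes its own square equal to its negative, and 2 is invertible.\<close>
    then have "br a a \<in> G 0" using br_G[of a x a x] by (cases x) auto
    then have "br (br a a) (br a a) = - br (br a a) (br a a)"
      using br_skew[of "br a a" 0 "br a a" 0] by (simp add: koszul_sign_def)
    then have "(2::'k) *s br (br a a) (br a a) = 0"
      using scale_left_distrib[of 1 1 "br (br a a) (br a a)"] by (simp add: eq_neg_iff_add_eq_0)
    then show ?thesis by simp
  qed
qed (rule nil_S)

theorem long_words_vanish:
  "\<exists>n. \<forall>v\<in>span F. \<forall>xs\<in>lists (span F). length xs = n \<longrightarrow> foldl br v xs = 0"
proof -
  obtain n where "\<forall>v\<in>span S. \<forall>xs\<in>lists (span S). length xs = n \<longrightarrow> foldl br v xs = 0"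
    using engel by blast
  then show ?thesis using span_S lists_mono[OF span_S] by (intro exI[of _ n]) blast
qed

end

subsection \<open>Extension of scalars\<close>

sublocale lie_superalgebra \<subseteq> bilinear_algebra scale br
proof
  have L: "module_hom scale scale (\<lambda>y. br x y)" for x
    using linear_br_right by (rule Vector_Spaces.linear.axioms(3))
  have R: "module_hom scale scale (\<lambda>x. br x y)" for y
    using linear_br_left by (rule Vector_Spaces.linear.axioms(3))
  show "br (x + y) z = br x z + br y z" "br x (y + z) = br x y + br x z"
    "br (c *s x) y = c *s br x y" "br x (c *s y) = c *s br x y" for x y z c
    by (rule module_hom.add[OF R] module_hom.add[OF L] module_hom.scale[OF R] module_hom.scale[OF L])+
qed

section \<open>Right multiplications in a Lie superalgebra\<close>

context lie_superalgebra
begin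

text \<open>The Jacobi identity with all brackets turned by skew-symmetry so that \<open>v\<close>
  stands first; the signs are checked for all eight choices of degrees.\<close>

lemma super_jacobi_right_homogeneous:
  assumes v: "v \<in> gr z" and a: "a \<in> gr x" and b: "b \<in> gr y"
  shows "br (br v a) b = koszul_sign x y *s br (br v b) a + br v (br a b)"
proof -
  have neg: "br p (- q) = - br p q" for p q
    using br_scale_right[of p "- 1" q] by simp
  have 1: "br b v = - (koszul_sign y z *s br v b)"
    by (rule super_skew[OF b v])
  have 2: "br a (br v b) = - (koszul_sign x (z + y) *s br (br v b) a)"
    by (rule super_skew[OF a br_even[OF v b]])
  have 3: "br b (br v a) = - (koszul_sign y (z + x) *s br (br v a) b)"
    by (rule super_skew[OF b br_even[OF v a]])
  have "koszul_sign z y *s br v (br a b) + koszul_sign z x *s br a (br b v)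
      + koszul_sign x y *s br b (br v a) = 0"
    by (rule super_jacobi[OF v a b])
  then show ?thesis
    unfolding 1 neg br_scale_right 2 3
    by (cases x; cases y; cases z) (auto simp: koszul_sign_def algebra_simps eq_neg_iff_add_eq_0)
qed

text \<open>The sign does not involve the degree of \<open>v\<close>, so the identity is additive in
  \<open>v\<close> and extends to inhomogeneous elements.\<close>

lemma super_jacobi_right:
  assumes "a \<in> gr x" "b \<in> gr y"
  shows "br (br v a) b = koszul_sign x y *s br (br v b) a + br v (br a b)"
proof -
  obtain u w where v: "u \<in> gr 0" "w \<in> gr 1" "v = u + w" using gr_sum by blast
  show ?thesis
    unfolding v(3) br_add_left scale_right_distrib
      super_jacobi_right_homogeneous[OF v(1) assms] super_jacobi_right_homogeneous[OF v(2) assms]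
    by simp
qed

end

definition fun_scale :: "'l::field \<Rightarrow> ('a \<Rightarrow> 'l) \<Rightarrow> 'a \<Rightarrow> 'l" where
  "fun_scale c f = (\<lambda>b. c * f b)"

interpretation fun_space: vector_space fun_scale
  by standard (auto simp: fun_scale_def fun_eq_iff algebra_simps)

lemma to_ac_koszul_sign [simp]: "to_ac (koszul_sign i j) = koszul_sign i j"
  by (simp add: koszul_sign_def)

text \<open>The scalar extension of a space with finite basis \<open>B\<close> is realised by the functions
  supported on \<open>B\<close>, inside the space of all functions.\<close>

locale scalar_extension = vector_space scale
  for scale :: "'k::field \<Rightarrow> 'a::ab_group_add \<Rightarrow> 'a"  (infixr \<open>*s\<close> 75) +
  fixes B :: "'a set"
  assumes finite_B: "finite B" and indep_B: "independent B" and span_B: "span B = UNIV"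
begin

text \<open>The map sending x to 1 tensor x, in coordinates with respect to
  \<open>B\<close>.\<close>

definition emb :: "'a \<Rightarrow> 'a \<Rightarrow> 'k alg_closure" where
  "emb x = (\<lambda>b. to_ac (representation B x b))"

lemma emb_add: "emb (x + y) = emb x + emb y"
  by (auto simp: emb_def fun_eq_iff representation_add indep_B span_B)

lemma emb_scale: "emb (c *s x) = fun_scale (to_ac c) (emb x)"
  by (auto simp: emb_def fun_eq_iff fun_scale_def representation_scale indep_B span_B)

lemma emb_zero [simp]: "emb 0 = 0"
  using emb_scale[of 0 0] by simp

lemma emb_uminus: "emb (- x) = - emb x"
  using emb_add[of x "- x"] by (simp add: eq_neg_iff_add_eq_0 add.commute)

lemma emb_sum: "emb (\<Sum>i\<in>I. f i) = (\<Sum>i\<in>I. emb (f i))"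
  by (induction I rule: infinite_finite_induct) (auto simp: emb_add)

lemma basis_expansion: "(\<Sum>b\<in>B. representation B x b *s b) = x"
  by (rule sum_representation_eq) (auto simp: indep_B span_B finite_B)

lemma emb_expansion: "emb x = (\<Sum>b\<in>B. fun_scale (emb x b) (emb b))"
proof -
  have "emb x = emb (\<Sum>b\<in>B. representation B x b *s b)" by (simp add: basis_expansion)
  also have "\<dots> = (\<Sum>b\<in>B. fun_scale (emb x b) (emb b))"
    unfolding emb_sum emb_scale by (simp add: emb_def)
  finally show ?thesis .
qed

lemma emb_eq_0: "emb x = 0 \<Longrightarrow> x = 0"
  using basis_expansion[of x] by (auto simp: emb_def fun_eq_iff)

text \<open>Here \<open>f\<close> stands for the formal combination of basis vectors with
  coefficients \<open>f i\<close>. Only values on \<open>B\<close> are read, so the extension is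
  linear on all functions, without support conditions.\<close>

definition ext_op :: "('a \<Rightarrow> 'a) \<Rightarrow> ('a \<Rightarrow> 'k alg_closure) \<Rightarrow> 'a \<Rightarrow> 'k alg_closure" where
  "ext_op D f = (\<Sum>i\<in>B. fun_scale (f i) (emb (D i)))"

definition ext_br ::
  "('a \<Rightarrow> 'a \<Rightarrow> 'a) \<Rightarrow> ('a \<Rightarrow> 'k alg_closure) \<Rightarrow> ('a \<Rightarrow> 'k alg_closure) \<Rightarrow> 'a \<Rightarrow> 'k alg_closure" where
  "ext_br br f g = (\<Sum>i\<in>B. \<Sum>j\<in>B. fun_scale (f i * g j) (emb (br i j)))"

lemma ext_op_linear: "linear_operator fun_scale (ext_op D)"
proof
  show "ext_op D (f + g) = ext_op D f + ext_op D g" for f g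
    by (simp add: ext_op_def fun_space.scale_left_distrib sum.distrib)
  have "fun_scale c f i = c * f i" for c i and f :: "'a \<Rightarrow> 'k alg_closure"
    by (simp add: fun_scale_def)
  then show "ext_op D (fun_scale c f) = fun_scale c (ext_op D f)" for c f
    by (simp add: ext_op_def fun_space.scale_sum_right)
qed

lemma ext_br_bilinear: "bilinear_algebra fun_scale (ext_br br)"
proof
  fix f g h :: "'a \<Rightarrow> 'k alg_closure" and c
  have s: "fun_scale c f i = c * f i" for f :: "'a \<Rightarrow> 'k alg_closure" and i
    by (simp add: fun_scale_def)
  show "ext_br br (f + g) h = ext_br br f h + ext_br br g h"
    "ext_br br f (g + h) = ext_br br f g + ext_br br f h"
    by (simp_all add: ext_br_def distrib_left distrib_right fun_space.scale_left_distrib sum.distrib)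
  show "ext_br br (fun_scale c f) g = fun_scale c (ext_br br f g)"
    "ext_br br f (fun_scale c g) = fun_scale c (ext_br br f g)"
    by (simp_all add: ext_br_def s fun_space.scale_sum_right mult_ac)
qed

lemma ext_op_emb:
  assumes "linear_operator scale D"
  shows "ext_op D (emb x) = emb (D x)"
proof -
  interpret linear_operator scale D by fact
  have "emb (D x) = emb (\<Sum>b\<in>B. representation B x b *s D b)"
    by (metis (no_types, lifting) D_scale D_sum basis_expansion sum.cong)
  then show ?thesis unfolding emb_sum emb_scale by (simp add: ext_op_def emb_def)
qed

lemma ext_br_emb:
  assumes "bilinear_algebra scale br"
  shows "ext_br br (emb x) (emb y) = emb (br x y)"
proof -
  interpret bilinear_algebra scale br by fact
  have "br x y = br (\<Sum>b\<in>B. representation B x b *s b) (\<Sum>b\<in>B. representation B y b *s b)"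
    by (simp add: basis_expansion)
  also have "\<dots> = (\<Sum>i\<in>B. representation B x i *s br i (\<Sum>j\<in>B. representation B y j *s j))"
    by (simp only: br_sum_left br_scale_left)
  also have "\<dots> = (\<Sum>i\<in>B. \<Sum>j\<in>B. (representation B x i * representation B y j) *s br i j)"
    by (simp add: br_sum_right br_scale_right scale_sum_right)
  finally show ?thesis
    by (simp add: emb_sum emb_scale ext_br_def) (simp add: emb_def)
qed

lemma emb_in_span: "emb x \<in> fun_space.span (emb ` B)"
  by (subst emb_expansion) (intro fun_space.span_sum fun_space.span_scale fun_space.span_base imageI)

definition proj :: "('a \<Rightarrow> 'k alg_closure) \<Rightarrow> 'a \<Rightarrow> 'k alg_closure" where
  "proj f = (\<Sum>b\<in>B. fun_scale (f b) (emb b))"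

lemma proj_in_span: "proj f \<in> fun_space.span (emb ` B)"
  unfolding proj_def by (intro fun_space.span_sum fun_space.span_scale fun_space.span_base imageI)

lemma proj_apply: "b \<in> B \<Longrightarrow> proj f b = f b"
proof -
  assume b: "b \<in> B"
  have ap: "(\<Sum>i\<in>I. h i) b = (\<Sum>i\<in>I. h i b)" for I and h :: "'a \<Rightarrow> 'a \<Rightarrow> 'k alg_closure"
    by (induction I rule: infinite_finite_induct) auto
  have "proj f b = (\<Sum>c\<in>B. f c * to_ac (if b = c then 1 else 0))"
    unfolding proj_def ap
    by (rule sum.cong) (auto simp: fun_scale_def emb_def representation_basis indep_B)
  also have "\<dots> = (\<Sum>c\<in>B. if b = c then f c else 0)"
    by (rule sum.cong) auto
  also have "\<dots> = f b" using b finite_B by simp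
  finally show ?thesis .
qed

lemma ext_op_proj: "ext_op D (proj f) = ext_op D f"
  unfolding ext_op_def by (rule sum.cong) (auto simp: proj_apply)

lemma ext_br_proj: "ext_br br (proj f) g = ext_br br f g" "ext_br br f (proj g) = ext_br br f g"
  unfolding ext_br_def by (auto intro!: sum.cong simp: proj_apply)

lemma word_emb:
  assumes "bilinear_algebra scale br"
  shows "foldl (ext_br br) (emb v) (map emb xs) = emb (foldl br v xs)"
  by (induction xs arbitrary: v) (simp_all add: ext_br_emb[OF assms])

end

section \<open>The scalar extension of a Lie superalgebra with derivation\<close>

locale lie_superalgebra_derivation = lie_superalgebra scale br gr + scalar_extension scale B
  for scale :: "'k::field_char_0 \<Rightarrow> 'a::ab_group_add \<Rightarrow> 'a"  (infixr \<open>*s\<close> 75)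
    and br and gr and B +
  fixes D :: "'a \<Rightarrow> 'a"
  assumes D_deriv: "even_superderivation scale br gr D" and D_bij: "bij D"
begin

lemma D_linear: "linear_operator scale D"
proof
  interpret Vector_Spaces.linear scale scale D
    using D_deriv by (simp add: even_superderivation_def)
  show "D (x + y) = D x + D y" "D (c *s x) = c *s D x" for x y c
    by (simp_all add: add scale)
qed

text \<open>Makes the inverse extendable too; its extension shows that the extension of
  \<open>D\<close> is injective.\<close>

lemma inv_D_linear: "linear_operator scale (inv_into UNIV D)"
proof -
  interpret linear_operator scale D by (rule D_linear)
  have D_inv: "D (inv_into UNIV D x) = x" for x
    using D_bij by (simp add: bij_is_surj surj_f_inv_f)
  have eqI: "inv_into UNIV D y = x" if "D x = y" for x y
    using that D_bij by (metis bij_is_inj inv_f_f)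
  show ?thesis
    by standard (auto intro!: eqI simp: D_add D_scale D_inv)
qed

lemma bilin: "bilinear_algebra scale br"
  by (rule bilinear_algebra_axioms)

interpretation ED: linear_operator fun_scale "ext_op D"
  by (rule ext_op_linear)

interpretation ED_inv: linear_operator fun_scale "ext_op (inv_into UNIV D)"
  by (rule ext_op_linear)

interpretation EB: bilinear_algebra fun_scale "ext_br br"
  by (rule ext_br_bilinear)

lemmas ext_simps = ED.D_add ED.D_scale EB.br_add_left EB.br_add_right EB.br_scale_left EB.br_scale_right

text \<open>All identities are linear in each argument, so span induction reduces them to embedded
  elements, where they are the original identities.\<close>

lemma ext_graded_derivation:
  "graded_derivation fun_scale (ext_br br) (ext_op D) (\<lambda>i. fun_space.span (emb ` gr i)) (emb ` B)"
proof (intro_locales, unfold_locales)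
  let ?G = "\<lambda>i. fun_space.span (emb ` gr i)"
  show "fun_space.subspace (?G i)" for i by simp
  show "finite (emb ` B)" using finite_B by simp
  show "?G i \<subseteq> fun_space.span (emb ` B)" for i
    by (rule fun_space.span_minimal) (auto simp: emb_in_span)
  show "emb ` B \<subseteq> fun_space.span (?G 0 \<union> ?G 1)"
  proof safe
    fix b
    obtain u w where v: "u \<in> gr 0" "w \<in> gr 1" "b = u + w" using gr_sum by blast
    then have "emb u \<in> fun_space.span (?G 0 \<union> ?G 1)" "emb w \<in> fun_space.span (?G 0 \<union> ?G 1)"
      by (auto intro!: fun_space.span_base)
    then show "emb b \<in> fun_space.span (?G 0 \<union> ?G 1)"
      unfolding v(3) emb_add by (rule fun_space.span_add)
  qed
  show "ext_op D ` ?G i \<subseteq> ?G i" for i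
  proof safe
    fix f assume "f \<in> ?G i"
    then show "ext_op D f \<in> ?G i"
    proof (rule fun_space.span_induct)
      show "fun_space.subspace {f. ext_op D f \<in> ?G i}"
        by (auto simp: fun_space.subspace_def ext_simps fun_space.span_zero fun_space.span_add fun_space.span_scale)
      have "D ` gr i \<subseteq> gr i" using D_deriv by (simp add: even_superderivation_def)
      then show "ext_op D f \<in> ?G i" if "f \<in> emb ` gr i" for f
        using that by (auto simp: ext_op_emb[OF D_linear] intro!: fun_space.span_base)
    qed
  qed
  show "f = 0" if f: "f \<in> fun_space.span (emb ` B)" "ext_op D f = 0" for f
  proof -
    have "ext_op (inv_into UNIV D) (ext_op D f) = f"
      using f(1)
    proof (rule fun_space.span_induct)
      show "fun_space.subspace {f. ext_op (inv_into UNIV D) (ext_op D f) = f}"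
        by (auto simp: fun_space.subspace_def ext_simps ED_inv.D_add ED_inv.D_scale)
      show "ext_op (inv_into UNIV D) (ext_op D f) = f" if "f \<in> emb ` B" for f
        using that D_bij by (auto simp: ext_op_emb D_linear inv_D_linear bij_def)
    qed
    then show ?thesis using f(2) by simp
  qed
  show "ext_op D (ext_br br f g) = ext_br br (ext_op D f) g + ext_br br f (ext_op D g)" for f g
  proof -
    \<comment> \<open>The Leibniz rule is required for arbitrary functions, but induction reaches
      only the span; \<open>proj\<close> bridges the two.\<close>
    have "ext_op D (ext_br br (proj f) (proj g))
        = ext_br br (ext_op D (proj f)) (proj g) + ext_br br (proj f) (ext_op D (proj g))"
      using proj_in_span proj_in_span
    proof (rule fun_space.span_induct2)
      fix a c assume "a \<in> emb ` B" "c \<in> emb ` B"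
      moreover have "D (br p q) = br (D p) q + br p (D q)" for p q
        using D_deriv by (simp add: even_superderivation_def)
      ultimately show "ext_op D (ext_br br a c) = ext_br br (ext_op D a) c + ext_br br a (ext_op D c)"
        by (auto simp: ext_op_emb[OF D_linear] ext_br_emb[OF bilin] emb_add)
    qed (auto simp: fun_space.subspace_def ext_simps fun_space.scale_right_distrib
        simp del: plus_fun_apply zero_fun_apply uminus_apply)
    then show ?thesis by (simp add: ext_op_proj ext_br_proj)
  qed
  show "ext_br br f g \<in> ?G (i + j)" if "f \<in> ?G i" "g \<in> ?G j" for f g i j
  proof (rule EB.br_span_in_subspace[OF _ _ that])
    fix a c assume "a \<in> emb ` gr i" "c \<in> emb ` gr j"
    then obtain p q where "p \<in> gr i" "q \<in> gr j" "a = emb p" "c = emb q" by blast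
    then show "ext_br br a c \<in> ?G (i + j)"
      using br_even by (simp add: ext_br_emb[OF bilin] fun_space.span_base)
  qed simp
  show "ext_br br f g = - fun_scale (koszul_sign i j) (ext_br br g f)"
    if "f \<in> ?G i" "g \<in> ?G j" for f g i j
    using that
  proof (rule fun_space.span_induct2)
    fix a c assume "a \<in> emb ` gr i" "c \<in> emb ` gr j"
    then obtain p q where pq: "p \<in> gr i" "q \<in> gr j" "a = emb p" "c = emb q" by blast
    then show "ext_br br a c = - fun_scale (koszul_sign i j) (ext_br br c a)"
      using super_skew[OF pq(1,2)] by (simp add: pq ext_br_emb[OF bilin] emb_uminus emb_scale)
  qed (auto simp: fun_space.subspace_def ext_simps fun_space.scale_right_distrib mult.commute
      simp del: plus_fun_apply zero_fun_apply uminus_apply)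
  show "ext_br br (ext_br br v f) g
      = fun_scale (koszul_sign i j) (ext_br br (ext_br br v g) f) + ext_br br v (ext_br br f g)"
    if "f \<in> ?G i" "g \<in> ?G j" "v \<in> fun_space.span (emb ` B)" for f g i j v
    using that(1,2)
  proof (rule fun_space.span_induct2)
    fix a c assume "a \<in> emb ` gr i" "c \<in> emb ` gr j"
    then obtain p q where pq: "p \<in> gr i" "q \<in> gr j" "a = emb p" "c = emb q" by blast
    show "ext_br br (ext_br br v a) c
        = fun_scale (koszul_sign i j) (ext_br br (ext_br br v c) a) + ext_br br v (ext_br br a c)"
      \<comment> \<open>A separate induction for the third argument, which ranges over the whole
        algebra while the other two are homogeneous.\<close>
      using that(3)
    proof (rule fun_space.span_induct)
      fix u assume "u \<in> emb ` B"
      then obtain r where "u = emb r" by blast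
      then show "ext_br br (ext_br br u a) c
          = fun_scale (koszul_sign i j) (ext_br br (ext_br br u c) a) + ext_br br u (ext_br br a c)"
        using super_jacobi_right[OF pq(1,2), of r]
        by (simp add: pq ext_br_emb[OF bilin] emb_add emb_scale)
    qed (auto simp: fun_space.subspace_def ext_simps fun_space.scale_right_distrib mult.commute
        simp del: plus_fun_apply zero_fun_apply uminus_apply)
  qed (auto simp: fun_space.subspace_def ext_simps fun_space.scale_right_distrib mult.commute
      simp del: plus_fun_apply zero_fun_apply uminus_apply)
qed

text \<open>Words commute with \<open>emb\<close>, which is injective, so vanishing over the
  algebraic closure descends.\<close>

lemma long_words_vanish: "\<exists>n. \<forall>v xs. length xs = n \<longrightarrow> foldl br v xs = 0"
proof -
  interpret graded_derivation fun_scale "ext_br br" "ext_op D" "\<lambda>i. fun_space.span (emb ` gr i)" "emb ` B"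
    by (rule ext_graded_derivation)
  obtain n where n: "\<forall>v\<in>fun_space.span (emb ` B). \<forall>xs\<in>lists (fun_space.span (emb ` B)).
      length xs = n \<longrightarrow> foldl (ext_br br) v xs = 0"
    using long_words_vanish by blast
  have "foldl br v xs = 0" if "length xs = n" for v xs
  proof -
    have "foldl (ext_br br) (emb v) (map emb xs) = 0"
      using that emb_in_span
      by (intro n[rule_format]) auto
    then show ?thesis by (simp add: word_emb[OF bilin] emb_eq_0)
  qed
  then show ?thesis by blast
qed

end

text \<open>The series brackets with the whole algebra on the right, so each step appends one entry
  to a left-normed word.\<close>

lemma (in bilinear_algebra) lower_central_words:
  "lower_central scale br k \<subseteq> span {foldl br v xs | v xs. length xs = k}"
proof (induction k)
  case 0
  show ?case by (auto intro!: span_base)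
next
  case (Suc k)
  let ?W = "\<lambda>k. {foldl br v xs | v xs. length xs = k}"
  have "br x y \<in> span (?W (Suc k))" if "x \<in> lower_central scale br k" for x y
  proof (rule br_span_in_subspace[OF subspace_span])
    show "x \<in> span (?W k)" using that Suc by blast
    show "y \<in> span {y}" by (simp add: span_base)
    fix a c assume "a \<in> ?W k" "c \<in> {y}"
    then obtain v xs where "a = foldl br v xs" "length xs = k" "c = y" by blast
    then have "br a c = foldl br v (xs @ [y])" "length (xs @ [y]) = Suc k" by auto
    then show "br a c \<in> span (?W (Suc k))" by (blast intro: span_base)
  qed
  then have "{br p q | p q. p \<in> lower_central scale br k \<and> q \<in> UNIV} \<subseteq> span (?W (Suc k))" by blast
  then show ?case by (simp add: bracket_space_def span_minimal)
qed

theorem theorem4p1: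
  fixes scale :: "'k::field_char_0 \<Rightarrow> 'a::ab_group_add \<Rightarrow> 'a"
    and br :: "'a \<Rightarrow> 'a \<Rightarrow> 'a"
    and gr :: "bit \<Rightarrow> 'a set"
  assumes "lie_superalgebra scale br gr"
    and "\<exists>B. finite_dimensional_vector_space scale B"
    and "\<exists>D. even_superderivation scale br gr D \<and> bij D"
  shows "nilpotent_superalgebra scale br"
proof -
  obtain B where "finite_dimensional_vector_space scale B" using assms(2) by blast
  then interpret finite_dimensional_vector_space scale B .
  obtain D where D: "even_superderivation scale br gr D" "bij D" using assms(3) by blast
  interpret lie_superalgebra scale br gr by fact
  interpret lie_superalgebra_derivation scale br gr B D
    by unfold_locales (use D finite_Basis independent_Basis span_Basis in auto)
  obtain n where "\<forall>v xs. length xs = n \<longrightarrow> foldl br v xs = 0"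
    using long_words_vanish by blast
  then have "{foldl br v xs | v xs. length xs = n} \<subseteq> {0}" by blast
  then have "span {foldl br v xs | v xs. length xs = n} \<subseteq> {0}"
    by (rule span_minimal) (rule subspace_single_0)
  then have sub: "lower_central scale br n \<subseteq> {0}"
    using lower_central_words by blast
  moreover have "0 \<in> lower_central scale br n"
    by (cases n) (simp_all add: bracket_space_def span_zero)
  ultimately show ?thesis unfolding nilpotent_superalgebra_def by blast
qed

end
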